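(* Let $(X,d)$ be a metric space. Let $M:X\rightrightarrows X$ be a multivalued mapping and let $f:\mathrm{dom}(M)\to\mathbb{R}$ satisfy $$f(x)-f(x')\le d(x',y)-d(x,y)\quad\text{for all }(x,y)\in G(M)\text{ and }x'\in\mathrm{dom}(M).\qquad(\ast)$$ Let $\emptyset\neq S\subset\mathrm{dom}(M)$. Then: (1) $f|_S$ extends to a $1$-Lipschitz function $h:X\to\mathbb{R}$ which satisfies $$h(x)-h(x')\le d(x',y)-d(x,y)\quad\text{for all }(x,y)\in G(M)\text{ and }x'\in X.\qquad(\ast\ast)$$ (2) The set $\mathcal{A}_{[-d,f|_S,M]}$ of all $1$-Lipschitz functions $h:X\to\mathbb{R}$ with $h|_S=f|_S$ and $(\ast\ast)$ is convex. (3) The function $\alpha_{[-d,f|_S,M]}:X\to\mathbb{R}$ defined by $$\alpha_{[-d,f|_S,M]}(x)=\sup\Big\{f(s)+\sum_{i=1}^{n-1}[d(x_i,y_i)-d(x_{i+1},y_i)]+d(x_n,y_n)-d(x,y_n)\Big\}$$ is the (pointwise) minimal $1$-Lipschitz function on $X$ that agrees with $f$ on $S$ and satisfies $(\ast\ast)$, and the function $\gamma_{[-d,f|_S,M]}:X\to\mathbb{R}$ defined by $$\gamma_{[-d,f|_S,M]}(x)=\inf\Big\{f(s)+\sum_{i=1}^{n-1}[d(x_i,y_{i+1})-d(x_{i+1},y_{i+1})]+d(x_n,x)\Big\}$$ is the (pointwise) maximal $1$-Lipschitz function on $X$ that agrees with $f$ on $S$ and satisfies $(\ast\ast)$. In both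 formulae the supremum/infimum is over all $s\in S$, all integers $n\ge1$ and all $(x_1,y_1),\dots,(x_n,y_n)\in G(M)$ with $x_1=s$. (4) If $S=\mathrm{dom}(M)$, then for all $x\in X$ $$\alpha_{[-d,f|_{\mathrm{dom}(M)},M]}(x)=\sup_{(s,t)\in G(M)}[f(s)+d(s,t)-d(x,t)]\quad\text{and}\quad\gamma_{[-d,f|_{\mathrm{dom}(M)},M]}(x)=\inf_{s\in\mathrm{dom}(M)}[f(s)+d(x,s)].$$ (5) In particular, suppose that $\emptyset\ne S\subset X$ and $f:S\to\mathbb{R}$ is $1$-Lipschitz. Then $M=I_S$, the identity mapping on $S$ (with graph $\{(s,s):s\in S\}$), satisfies $(\ast)$. As a consequence, $$\alpha_{[-d,f|_S,I_S]}(x)=\sup_{s\in S}[f(s)-d(x,s)]\quad\text{and}\quad\gamma_{[-d,f|_S,I_S]}(x)=\inf_{s\in S}[f(s)+d(x,s)]$$ are the minimal and maximal $1$-Lipschitz extensions of $f$ to $X$, respectively.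
   Context: For a multivalued mapping $M:X\rightrightarrows X$: $G(M)=\{(x,y): y\in M(x)\}$ and $\mathrm{dom}(M)=\{x: M(x)\neq\emptyset\}$. A function $h$ is $1$-Lipschitz if $|h(x)-h(y)|\le d(x,y)$ for all $x,y$ in its domain. *)

theory Defs
  imports "HOL-Analysis.Analysis"
begin

text \<open>A multivalued mapping from \<open>X\<close> to \<open>X\<close> is a set-valued function. A real function on
  \<open>dom M\<close> or on \<open>S\<close> is a total function whose values are only used on that set.\<close>

definition mv_graph :: "('a \<Rightarrow> 'a set) \<Rightarrow> ('a \<times> 'a) set"
  where "mv_graph M = {(x, y). y \<in> M x}"

definition mv_dom :: "('a \<Rightarrow> 'a set) \<Rightarrow> 'a set"
  where "mv_dom M = {x. M x \<noteq> {}}"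

definition mv_id :: "'a set \<Rightarrow> 'a \<Rightarrow> 'a set"
  where "mv_id S x = (if x \<in> S then {x} else {})"

text \<open>The condition \<open>(\<ast>)\<close> is the case \<open>D = mv_dom M\<close>, and \<open>(\<ast>\<ast>)\<close> is the case \<open>D = UNIV\<close>.\<close>

definition star_cond :: "'a::metric_space set \<Rightarrow> ('a \<Rightarrow> 'a set) \<Rightarrow> ('a \<Rightarrow> real) \<Rightarrow> bool"
  where "star_cond D M f \<longleftrightarrow>
    (\<forall>(x, y) \<in> mv_graph M. \<forall>x' \<in> D. f x - f x' \<le> dist x' y - dist x y)"

definition lip_extensions :: "('a::metric_space \<Rightarrow> real) \<Rightarrow> 'a set \<Rightarrow> ('a \<Rightarrow> real) set"
  where "lip_extensions f S = {h. 1-lipschitz_on UNIV h \<and> (\<forall>s\<in>S. h s = f s)}"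

text \<open>The set written \<open>\<A>\<close> with subscript \<open>[-d, f|\<^sub>S, M]\<close>; the cost \<open>-d\<close> is fixed throughout.\<close>

definition ext_family ::
    "('a::metric_space \<Rightarrow> real) \<Rightarrow> 'a set \<Rightarrow> ('a \<Rightarrow> 'a set) \<Rightarrow> ('a \<Rightarrow> real) set"
  where "ext_family f S M = {h \<in> lip_extensions f S. star_cond UNIV M h}"

text \<open>This is the library predicate \<open>convex\<close> unfolded pointwise: the function type is not an
  instance of \<open>real_vector\<close>.\<close>

definition fun_convex :: "('a \<Rightarrow> real) set \<Rightarrow> bool"
  where "fun_convex A \<longleftrightarrow>
    (\<forall>g\<in>A. \<forall>h\<in>A. \<forall>u\<ge>0. \<forall>v\<ge>0. u + v = 1 \<longrightarrow> (\<lambda>x. u * g x + v * h x) \<in> A)"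

definition is_pw_least :: "('a \<Rightarrow> real) \<Rightarrow> ('a \<Rightarrow> real) set \<Rightarrow> bool"
  where "is_pw_least g A \<longleftrightarrow> g \<in> A \<and> (\<forall>h\<in>A. \<forall>x. g x \<le> h x)"

definition is_pw_greatest :: "('a \<Rightarrow> real) \<Rightarrow> ('a \<Rightarrow> real) set \<Rightarrow> bool"
  where "is_pw_greatest g A \<longleftrightarrow> g \<in> A \<and> (\<forall>h\<in>A. \<forall>x. h x \<le> g x)"

text \<open>The chain \<open>(x\<^sub>1, y\<^sub>1), \<dots>, (x\<^sub>n, y\<^sub>n)\<close> in the graph is given by two sequences of which only the
  entries \<open>1, \<dots>, n\<close> matter. For \<open>n = 1\<close> the range \<open>1..n-1\<close> is empty.\<close>

definition mv_chain :: "('a \<Rightarrow> 'a set) \<Rightarrow> 'a \<Rightarrow> nat \<Rightarrow> (nat \<Rightarrow> 'a) \<Rightarrow> (nat \<Rightarrow> 'a) \<Rightarrow> bool"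
  where "mv_chain M s n x y \<longleftrightarrow>
    n \<ge> 1 \<and> (\<forall>i\<in>{1..n}. (x i, y i) \<in> mv_graph M) \<and> x 1 = s"

definition alpha_vals ::
    "('a::metric_space \<Rightarrow> real) \<Rightarrow> 'a set \<Rightarrow> ('a \<Rightarrow> 'a set) \<Rightarrow> 'a \<Rightarrow> real set"
  where "alpha_vals f S M z =
    {f s + (\<Sum>i=1..n-1. dist (x i) (y i) - dist (x (i+1)) (y i)) + dist (x n) (y n) - dist z (y n)
      | s n x y. s \<in> S \<and> mv_chain M s n x y}"

definition gamma_vals ::
    "('a::metric_space \<Rightarrow> real) \<Rightarrow> 'a set \<Rightarrow> ('a \<Rightarrow> 'a set) \<Rightarrow> 'a \<Rightarrow> real set"
  where "gamma_vals f S M z =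
    {f s + (\<Sum>i=1..n-1. dist (x i) (y (i+1)) - dist (x (i+1)) (y (i+1))) + dist (x n) z
      | s n x y. s \<in> S \<and> mv_chain M s n x y}"

text \<open>\<open>Sup\<close> and \<open>Inf\<close> on the reals are meaningful only for nonempty sets bounded on the relevant
  side. The theorem asserts this for both sets of values.\<close>

definition alpha_ext :: "('a::metric_space \<Rightarrow> real) \<Rightarrow> 'a set \<Rightarrow> ('a \<Rightarrow> 'a set) \<Rightarrow> 'a \<Rightarrow> real"
  where "alpha_ext f S M z = Sup (alpha_vals f S M z)"

definition gamma_ext :: "('a::metric_space \<Rightarrow> real) \<Rightarrow> 'a set \<Rightarrow> ('a \<Rightarrow> 'a set) \<Rightarrow> 'a \<Rightarrow> real"
  where "gamma_ext f S M z = Inf (gamma_vals f S M z)"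

end

theory Submission
  imports Defs
begin

text \<open>
  If the domain of \<open>M\<close> lies in \<open>D\<close>, the condition \<^term>\<open>star_cond D M h\<close> says that for \<open>(x, y)\<close> in
  the graph the function \<open>\<lambda>z. h z + dist z y\<close> attains its minimum over \<open>D\<close> at \<open>x\<close>. Read along a
  chain of graph points it can be telescoped in two directions.

  Going up, \<open>h (x i) + dist (x i) (y i) - dist (x (i+1)) (y i) \<le> h (x (i+1))\<close>. So every value in the
  supremum is at most \<open>h a + dist a b - dist z b\<close>, where \<open>(a, b)\<close> is the last pair of the chain
  (\<open>alpha_vals_le_last_pair\<close>), and one more use of the condition bounds this by \<open>h z\<close>. Going down,
  \<open>h (x (i+1)) \<le> h (x i) + dist (x i) (y (i+1)) - dist (x (i+1)) (y (i+1))\<close>. So every value in the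
  infimum is at least \<open>h a + dist a z\<close> (\<open>gamma_vals_ge_last_point\<close>), and the Lipschitz condition bounds
  this from below by \<open>h z\<close>. Hence each admissible extension (a \<open>1\<close>-Lipschitz extension with
  the condition on the whole space) lies between the two envelopes.

  That the envelopes are themselves admissible rests on three facts. As functions of \<open>z\<close> the values
  along a fixed chain are \<open>1\<close>-Lipschitz, and this passes to suprema and infima. Chains of length one
  give the values of \<open>f\<close> on \<open>S\<close>, and no chain does better there, by the two bounds applied to \<open>h = f\<close>
  on the domain of \<open>M\<close>. Finally a graph point may be appended to a chain: for the
  supremum this changes a value at \<open>x\<close> into one at \<open>x'\<close>, for the infimum a value at \<open>x'\<close> into one
  at \<open>x\<close>, and the difference is within what the condition allows (\<open>alpha_vals_append\<close>,
  \<open>gamma_vals_append\<close>). So the condition holds for the envelopes on the whole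
  space although \<open>f\<close> satisfies it only on the domain.

  If \<open>S\<close> is the whole domain, the last pair of a chain already is a chain of length one, and so the
  bounds in terms of that pair collapse both envelopes to chains of length one. For the identity mapping
  on \<open>S\<close> the condition follows from the Lipschitz condition, which gives the classical extremal
  extensions.
\<close>

section \<open>Consequences of the condition along chains\<close>

lemma star_condD:
  assumes "star_cond D M h" "(x, y) \<in> mv_graph M" "x' \<in> D"
  shows "h x + dist x y \<le> h x' + dist x' y"
  using assms by (force simp: star_cond_def)

lemma fst_graph_in_dom: "(x, y) \<in> mv_graph M \<Longrightarrow> x \<in> mv_dom M"
  by (auto simp: mv_graph_def mv_dom_def)

lemma dom_obtains_graph:
  assumes "x \<in> mv_dom M"
  obtains y where "(x, y) \<in> mv_graph M"
  using assms by (auto simp: mv_graph_def mv_dom_def)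

text \<open>The Lipschitz bound is automatic at points of the domain, by the triangle inequality through
  any \<open>y\<close> in the image of \<open>x\<close>.\<close>

lemma star_cond_le_dist:
  assumes "star_cond D M h" "x \<in> mv_dom M" "x' \<in> D"
  shows "h x \<le> h x' + dist x x'"
proof -
  obtain y where "(x, y) \<in> mv_graph M"
    using assms(2) by (rule dom_obtains_graph)
  from star_condD[OF assms(1) this assms(3)] show ?thesis
    using dist_triangle[of x' y x] by (simp add: dist_commute)
qed

lemma mv_chain_graph: "mv_chain M s n x y \<Longrightarrow> 1 \<le> i \<Longrightarrow> i \<le> n \<Longrightarrow> (x i, y i) \<in> mv_graph M"
  by (auto simp: mv_chain_def)

lemma mv_chain_singleton: "(s, t) \<in> mv_graph M \<Longrightarrow> mv_chain M s 1 (\<lambda>_. s) (\<lambda>_. t)"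
  by (auto simp: mv_chain_def)

lemma mv_chain_append:
  assumes "mv_chain M s n x y" "(a, b) \<in> mv_graph M"
  shows "mv_chain M s (Suc n) (x(Suc n := a)) (y(Suc n := b))"
  using assms by (auto simp: mv_chain_def)

text \<open>The upward telescoping: the condition at the pair with index \<open>i\<close>, tested at \<open>x (i + 1)\<close>, bounds
  the \<open>i\<close>-th summand by the increase of \<open>h\<close>.\<close>

lemma ascending_chain_sum_le:
  assumes "star_cond D M h" "mv_dom M \<subseteq> D" "mv_chain M s n x y" "1 \<le> k" "k \<le> n"
  shows "h s + (\<Sum>i=1..k-1. dist (x i) (y i) - dist (x (i+1)) (y i)) \<le> h (x k)"
  using assms(4,5)
proof (induction k rule: dec_induct)
  case base
  then show ?case using assms(3) by (simp add: mv_chain_def)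
next
  case (step k)
  have "(x k, y k) \<in> mv_graph M" "x (Suc k) \<in> D"
    using step assms(2) mv_chain_graph[OF assms(3)] fst_graph_in_dom[of "x (Suc k)" "y (Suc k)" M]
    by auto
  then have "h (x k) + dist (x k) (y k) \<le> h (x (Suc k)) + dist (x (Suc k)) (y k)"
    by (rule star_condD[OF assms(1)])
  moreover have "(\<Sum>i=1..k. dist (x i) (y i) - dist (x (i+1)) (y i))
      = (\<Sum>i=1..k-1. dist (x i) (y i) - dist (x (i+1)) (y i))
        + (dist (x k) (y k) - dist (x (Suc k)) (y k))"
    using step.hyps by (cases k) simp_all
  ultimately show ?case using step by simp
qed

text \<open>The downward telescoping: here the condition is used at the pair with index \<open>i + 1\<close> and tested
  at \<open>x i\<close>, so that the \<open>i\<close>-th summand bounds the increase of \<open>h\<close> from above.\<close>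

lemma descending_chain_sum_ge:
  assumes "star_cond D M h" "mv_dom M \<subseteq> D" "mv_chain M s n x y" "1 \<le> k" "k \<le> n"
  shows "h (x k) \<le> h s + (\<Sum>i=1..k-1. dist (x i) (y (i+1)) - dist (x (i+1)) (y (i+1)))"
  using assms(4,5)
proof (induction k rule: dec_induct)
  case base
  then show ?case using assms(3) by (simp add: mv_chain_def)
next
  case (step k)
  have "(x (Suc k), y (Suc k)) \<in> mv_graph M" "x k \<in> D"
    using step assms(2) mv_chain_graph[OF assms(3)] fst_graph_in_dom[of "x k" "y k" M]
    by auto
  then have "h (x (Suc k)) + dist (x (Suc k)) (y (Suc k)) \<le> h (x k) + dist (x k) (y (Suc k))"
    by (rule star_condD[OF assms(1)])
  moreover have "(\<Sum>i=1..k. dist (x i) (y (i+1)) - dist (x (i+1)) (y (i+1)))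
      = (\<Sum>i=1..k-1. dist (x i) (y (i+1)) - dist (x (i+1)) (y (i+1)))
        + (dist (x k) (y (Suc k)) - dist (x (Suc k)) (y (Suc k)))"
    using step.hyps by (cases k) simp_all
  ultimately show ?case using step by simp
qed

section \<open>The values under the supremum\<close>

lemma alpha_valsI:
  assumes "s \<in> S" "mv_chain M s n x y"
  shows "f s + (\<Sum>i=1..n-1. dist (x i) (y i) - dist (x (i+1)) (y i))
    + dist (x n) (y n) - dist z (y n) \<in> alpha_vals f S M z"
  using assms unfolding alpha_vals_def by blast

lemma alpha_valsE:
  assumes "v \<in> alpha_vals f S M z"
  obtains s n x y where "s \<in> S" "mv_chain M s n x y"
    "v = f s + (\<Sum>i=1..n-1. dist (x i) (y i) - dist (x (i+1)) (y i))
      + dist (x n) (y n) - dist z (y n)"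
  using assms unfolding alpha_vals_def by blast

lemma alpha_vals_singleton:
  assumes "s \<in> S" "(s, t) \<in> mv_graph M"
  shows "f s + dist s t - dist z t \<in> alpha_vals f S M z"
  using alpha_valsI[OF assms(1) mv_chain_singleton[OF assms(2)]] by simp

lemma alpha_vals_nonempty:
  assumes "S \<noteq> {}" "S \<subseteq> mv_dom M"
  shows "alpha_vals f S M z \<noteq> {}"
proof -
  obtain s where s: "s \<in> S" "s \<in> mv_dom M" using assms by blast
  obtain t where "(s, t) \<in> mv_graph M" using s(2) by (rule dom_obtains_graph)
  from alpha_vals_singleton[OF s(1) this] show ?thesis by blast
qed

text \<open>Keeping the last pair in the bound serves three purposes: it gives the bound by \<open>h z\<close>, it
  gives boundedness at points where the condition is not available, and it reduces arbitrary chains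
  to chains of length one.\<close>

lemma alpha_vals_le_last_pair:
  assumes "star_cond D M h" "mv_dom M \<subseteq> D" "\<forall>s\<in>S. h s = f s" "v \<in> alpha_vals f S M z"
  obtains a b where "(a, b) \<in> mv_graph M" "v \<le> h a + dist a b - dist z b"
proof -
  obtain s n x y where c: "s \<in> S" "mv_chain M s n x y"
    and v: "v = f s + (\<Sum>i=1..n-1. dist (x i) (y i) - dist (x (i+1)) (y i))
      + dist (x n) (y n) - dist z (y n)"
    using assms(4) by (rule alpha_valsE)
  have n: "1 \<le> n" using c(2) by (simp add: mv_chain_def)
  have "v \<le> h (x n) + dist (x n) (y n) - dist z (y n)"
    using ascending_chain_sum_le[OF assms(1,2) c(2) n order_refl] assms(3) c(1) v by auto
  with mv_chain_graph[OF c(2) n order_refl] show ?thesis by (rule that)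
qed

lemma alpha_vals_le:
  assumes "star_cond D M h" "mv_dom M \<subseteq> D" "\<forall>s\<in>S. h s = f s" "v \<in> alpha_vals f S M z" "z \<in> D"
  shows "v \<le> h z"
proof -
  obtain a b where "(a, b) \<in> mv_graph M" "v \<le> h a + dist a b - dist z b"
    using assms(1-4) by (rule alpha_vals_le_last_pair)
  with star_condD[OF assms(1) this(1) assms(5)] show ?thesis by linarith
qed

text \<open>At a point outside the domain the values are compared with those at a fixed point of \<open>S\<close>,
  at the cost of the distance between the two points.\<close>

lemma alpha_vals_bdd_above:
  assumes "star_cond (mv_dom M) M f" "S \<noteq> {}" "S \<subseteq> mv_dom M"
  shows "bdd_above (alpha_vals f S M z)"
proof -
  obtain s where s: "s \<in> S" "s \<in> mv_dom M" using assms(2,3) by blast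
  have "v \<le> f s + dist s z" if v: "v \<in> alpha_vals f S M z" for v
  proof -
    obtain a b where ab: "(a, b) \<in> mv_graph M" "v \<le> f a + dist a b - dist z b"
      using alpha_vals_le_last_pair[OF assms(1) order_refl _ v] by auto
    show ?thesis
      using star_condD[OF assms(1) ab(1) s(2)] ab(2) dist_triangle[of s b z] by linarith
  qed
  then show ?thesis by (rule bdd_aboveI)
qed

lemma alpha_vals_shift:
  assumes "v \<in> alpha_vals f S M z"
  shows "\<exists>w\<in>alpha_vals f S M z'. v - dist z z' \<le> w"
proof -
  obtain s n x y where c: "s \<in> S" "mv_chain M s n x y"
    and v: "v = f s + (\<Sum>i=1..n-1. dist (x i) (y i) - dist (x (i+1)) (y i))
      + dist (x n) (y n) - dist z (y n)"
    using assms by (rule alpha_valsE)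
  have "dist z' (y n) \<le> dist z z' + dist z (y n)"
    using dist_triangle[of z' "y n" z] by (simp add: dist_commute)
  then show ?thesis
    by (intro bexI[OF _ alpha_valsI[OF c]]) (simp add: v)
qed

text \<open>A chain ended at \<open>a\<close> by the term \<open>- dist a (y n)\<close> may be continued through \<open>(a, b)\<close>, since
  that term is the missing part of the new summand.\<close>

lemma alpha_vals_append:
  assumes "v \<in> alpha_vals f S M a" "(a, b) \<in> mv_graph M"
  shows "v + dist a b - dist z b \<in> alpha_vals f S M z"
proof -
  obtain s n x y where c: "s \<in> S" "mv_chain M s n x y"
    and v: "v = f s + (\<Sum>i=1..n-1. dist (x i) (y i) - dist (x (i+1)) (y i))
      + dist (x n) (y n) - dist a (y n)"
    using assms(1) by (rule alpha_valsE)
  obtain m where n: "n = Suc m"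
    using c(2) by (cases n) (auto simp: mv_chain_def)
  show ?thesis
    using alpha_valsI[OF c(1) mv_chain_append[OF c(2) assms(2)], of f z]
    by (simp add: v n algebra_simps)
qed

section \<open>The values under the infimum\<close>

lemma gamma_valsI:
  assumes "s \<in> S" "mv_chain M s n x y"
  shows "f s + (\<Sum>i=1..n-1. dist (x i) (y (i+1)) - dist (x (i+1)) (y (i+1))) + dist (x n) z
    \<in> gamma_vals f S M z"
  using assms unfolding gamma_vals_def by blast

lemma gamma_valsE:
  assumes "v \<in> gamma_vals f S M z"
  obtains s n x y where "s \<in> S" "mv_chain M s n x y"
    "v = f s + (\<Sum>i=1..n-1. dist (x i) (y (i+1)) - dist (x (i+1)) (y (i+1))) + dist (x n) z"
  using assms unfolding gamma_vals_def by blast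

lemma gamma_vals_singleton:
  assumes "s \<in> S" "s \<in> mv_dom M"
  shows "f s + dist s z \<in> gamma_vals f S M z"
proof -
  obtain t where "(s, t) \<in> mv_graph M" using assms(2) by (rule dom_obtains_graph)
  from gamma_valsI[OF assms(1) mv_chain_singleton[OF this]] show ?thesis by simp
qed

lemma gamma_vals_nonempty:
  assumes "S \<noteq> {}" "S \<subseteq> mv_dom M"
  shows "gamma_vals f S M z \<noteq> {}"
  using assms gamma_vals_singleton by blast

text \<open>The counterpart of \<open>alpha_vals_le_last_pair\<close>, used in the same three ways.\<close>

lemma gamma_vals_ge_last_point:
  assumes "star_cond D M h" "mv_dom M \<subseteq> D" "\<forall>s\<in>S. h s = f s" "v \<in> gamma_vals f S M z"
  obtains a where "a \<in> mv_dom M" "h a + dist a z \<le> v"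
proof -
  obtain s n x y where c: "s \<in> S" "mv_chain M s n x y"
    and v: "v = f s + (\<Sum>i=1..n-1. dist (x i) (y (i+1)) - dist (x (i+1)) (y (i+1))) + dist (x n) z"
    using assms(4) by (rule gamma_valsE)
  have n: "1 \<le> n" using c(2) by (simp add: mv_chain_def)
  have "h (x n) + dist (x n) z \<le> v"
    using descending_chain_sum_ge[OF assms(1,2) c(2) n order_refl] assms(3) c(1) v by auto
  with fst_graph_in_dom[OF mv_chain_graph[OF c(2) n order_refl]] show ?thesis by (rule that)
qed

lemma gamma_vals_ge:
  assumes "star_cond D M h" "mv_dom M \<subseteq> D" "\<forall>s\<in>S. h s = f s" "v \<in> gamma_vals f S M z"
    and "1-lipschitz_on D h" "z \<in> D"
  shows "h z \<le> v"
proof -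
  obtain a where a: "a \<in> mv_dom M" "h a + dist a z \<le> v"
    using assms(1-4) by (rule gamma_vals_ge_last_point)
  have "dist (h a) (h z) \<le> dist a z"
    using lipschitz_onD[OF assms(5), of a z] a(1) assms(2,6) by auto
  then show ?thesis using a(2) by (simp add: dist_real_def)
qed

lemma star_cond_dom_lipschitz:
  assumes "star_cond (mv_dom M) M f"
  shows "1-lipschitz_on (mv_dom M) f"
proof (rule lipschitz_onI)
  fix x y assume "x \<in> mv_dom M" "y \<in> mv_dom M"
  then show "dist (f x) (f y) \<le> 1 * dist x y"
    using star_cond_le_dist[OF assms, of x y] star_cond_le_dist[OF assms, of y x]
    by (simp add: dist_real_def dist_commute)
qed simp

lemma gamma_vals_bdd_below:
  assumes "star_cond (mv_dom M) M f" "S \<noteq> {}" "S \<subseteq> mv_dom M"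
  shows "bdd_below (gamma_vals f S M z)"
proof -
  obtain s where s: "s \<in> mv_dom M" using assms(2,3) by blast
  have "f s - dist s z \<le> v" if v: "v \<in> gamma_vals f S M z" for v
  proof -
    obtain a where a: "a \<in> mv_dom M" "f a + dist a z \<le> v"
      using gamma_vals_ge_last_point[OF assms(1) order_refl _ v] by auto
    show ?thesis
      using star_cond_le_dist[OF assms(1) s a(1)] a(2) dist_triangle[of s a z]
      by (simp add: dist_commute)
  qed
  then show ?thesis by (rule bdd_belowI)
qed

lemma gamma_vals_shift:
  assumes "v \<in> gamma_vals f S M z"
  shows "\<exists>w\<in>gamma_vals f S M z'. w \<le> v + dist z z'"
proof -
  obtain s n x y where c: "s \<in> S" "mv_chain M s n x y"
    and v: "v = f s + (\<Sum>i=1..n-1. dist (x i) (y (i+1)) - dist (x (i+1)) (y (i+1))) + dist (x n) z"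
    using assms by (rule gamma_valsE)
  have "dist (x n) z' \<le> dist (x n) z + dist z z'"
    by (rule dist_triangle)
  then show ?thesis
    by (intro bexI[OF _ gamma_valsI[OF c]]) (simp add: v)
qed

text \<open>Here a chain ended at \<open>z\<close> is continued through \<open>(a, b)\<close> and ended at \<open>a\<close> itself. The new
  summand contains \<open>dist (x n) b\<close>, which is at most \<open>dist (x n) z + dist z b\<close>: hence only an
  inequality.\<close>

lemma gamma_vals_append:
  assumes "v \<in> gamma_vals f S M z" "(a, b) \<in> mv_graph M"
  shows "\<exists>w\<in>gamma_vals f S M a. w \<le> v + dist z b - dist a b"
proof -
  obtain s n x y where c: "s \<in> S" "mv_chain M s n x y"
    and v: "v = f s + (\<Sum>i=1..n-1. dist (x i) (y (i+1)) - dist (x (i+1)) (y (i+1))) + dist (x n) z"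
    using assms(1) by (rule gamma_valsE)
  obtain m where n: "n = Suc m"
    using c(2) by (cases n) (auto simp: mv_chain_def)
  have "dist (x n) b \<le> dist (x n) z + dist z b"
    by (rule dist_triangle)
  then show ?thesis
    by (intro bexI[OF _ gamma_valsI[OF c(1) mv_chain_append[OF c(2) assms(2)]]]) (simp add: v n)
qed

section \<open>The extremal extensions\<close>

lemma ext_familyI:
  assumes "\<And>x y. h x \<le> h y + dist x y" "\<And>s. s \<in> S \<Longrightarrow> h s = f s"
    and "\<And>a b z. (a, b) \<in> mv_graph M \<Longrightarrow> h a + dist a b \<le> h z + dist z b"
  shows "h \<in> ext_family f S M"
proof -
  have "dist (h x) (h y) \<le> dist x y" for x y
    using assms(1)[of x y] assms(1)[of y x] by (simp add: dist_real_def dist_commute)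
  then have "1-lipschitz_on UNIV h" by (auto intro: lipschitz_onI)
  moreover have "star_cond UNIV M h"
    unfolding star_cond_def using assms(3) by (force simp: algebra_simps)
  ultimately show ?thesis using assms(2) by (simp add: ext_family_def lip_extensions_def)
qed

text \<open>With \<open>c = dist x z\<close> this gives the Lipschitz bound for the upper envelope of the chain values,
  and with \<open>c = dist z b - dist x b\<close> the condition at \<open>(x, b)\<close>.\<close>

lemma Sup_alpha_vals_transfer:
  assumes "star_cond (mv_dom M) M f" "S \<noteq> {}" "S \<subseteq> mv_dom M"
    and "\<And>v. v \<in> alpha_vals f S M x \<Longrightarrow> \<exists>w\<in>alpha_vals f S M z. v - c \<le> w"
  shows "alpha_ext f S M x \<le> alpha_ext f S M z + c"
  unfolding alpha_ext_def
proof (rule cSup_least[OF alpha_vals_nonempty[OF assms(2,3)]])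
  fix v assume "v \<in> alpha_vals f S M x"
  then obtain w where "w \<in> alpha_vals f S M z" "v - c \<le> w" using assms(4) by blast
  with cSup_upper[OF this(1) alpha_vals_bdd_above[OF assms(1-3)]]
  show "v \<le> Sup (alpha_vals f S M z) + c" by linarith
qed

lemma Inf_gamma_vals_transfer:
  assumes "star_cond (mv_dom M) M f" "S \<noteq> {}" "S \<subseteq> mv_dom M"
    and "\<And>v. v \<in> gamma_vals f S M z \<Longrightarrow> \<exists>w\<in>gamma_vals f S M x. w \<le> v + c"
  shows "gamma_ext f S M x - c \<le> gamma_ext f S M z"
  unfolding gamma_ext_def
proof (rule cInf_greatest[OF gamma_vals_nonempty[OF assms(2,3)]])
  fix v assume "v \<in> gamma_vals f S M z"
  then obtain w where "w \<in> gamma_vals f S M x" "w \<le> v + c" using assms(4) by blast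
  with cInf_lower[OF this(1) gamma_vals_bdd_below[OF assms(1-3)]]
  show "Inf (gamma_vals f S M x) - c \<le> v" by linarith
qed

theorem alpha_ext_least:
  assumes "star_cond (mv_dom M) M f" "S \<noteq> {}" "S \<subseteq> mv_dom M"
  shows "is_pw_least (alpha_ext f S M) (ext_family f S M)"
  unfolding is_pw_least_def
proof (intro conjI ballI allI)
  note transfer = Sup_alpha_vals_transfer[OF assms]
  show "alpha_ext f S M \<in> ext_family f S M"
  proof (rule ext_familyI)
    show "alpha_ext f S M x \<le> alpha_ext f S M y + dist x y" for x y
      by (rule transfer) (rule alpha_vals_shift)
  next
    fix s assume s: "s \<in> S"
    with assms(3) have dom: "s \<in> mv_dom M" by blast
    then obtain t where "(s, t) \<in> mv_graph M" by (rule dom_obtains_graph)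
    from alpha_vals_singleton[OF s this, of f s] have "f s \<in> alpha_vals f S M s" by simp
    moreover have "v \<le> f s" if "v \<in> alpha_vals f S M s" for v
      using alpha_vals_le[OF assms(1) order_refl _ that dom] by simp
    ultimately show "alpha_ext f S M s = f s"
      unfolding alpha_ext_def by (rule cSup_eq_maximum)
  next
    fix a b z assume "(a, b) \<in> mv_graph M"
    from alpha_vals_append[OF _ this]
    have "alpha_ext f S M a \<le> alpha_ext f S M z + (dist z b - dist a b)"
      by (intro transfer) (force simp: algebra_simps)
    then show "alpha_ext f S M a + dist a b \<le> alpha_ext f S M z + dist z b" by simp
  qed
next
  fix h x assume "h \<in> ext_family f S M"
  then have h: "star_cond UNIV M h" "\<forall>s\<in>S. h s = f s"
    by (auto simp: ext_family_def lip_extensions_def)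
  show "alpha_ext f S M x \<le> h x"
    unfolding alpha_ext_def
    using alpha_vals_nonempty[OF assms(2,3)] alpha_vals_le[OF h(1) _ h(2)]
    by (intro cSup_least) auto
qed

theorem gamma_ext_greatest:
  assumes "star_cond (mv_dom M) M f" "S \<noteq> {}" "S \<subseteq> mv_dom M"
  shows "is_pw_greatest (gamma_ext f S M) (ext_family f S M)"
  unfolding is_pw_greatest_def
proof (intro conjI ballI allI)
  note transfer = Inf_gamma_vals_transfer[OF assms]
  show "gamma_ext f S M \<in> ext_family f S M"
  proof (rule ext_familyI)
    fix x y
    have "gamma_ext f S M x - dist x y \<le> gamma_ext f S M y"
      using gamma_vals_shift[of _ f S M y x]
      by (intro transfer) (simp add: dist_commute)
    then show "gamma_ext f S M x \<le> gamma_ext f S M y + dist x y" by simp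
  next
    fix s assume s: "s \<in> S"
    with assms(3) have dom: "s \<in> mv_dom M" by blast
    from gamma_vals_singleton[OF s this, of f s] have "f s \<in> gamma_vals f S M s" by simp
    moreover have "f s \<le> v" if "v \<in> gamma_vals f S M s" for v
      using gamma_vals_ge[OF assms(1) order_refl _ that star_cond_dom_lipschitz[OF assms(1)] dom]
      by simp
    ultimately show "gamma_ext f S M s = f s"
      unfolding gamma_ext_def by (rule cInf_eq_minimum)
  next
    fix a b z assume "(a, b) \<in> mv_graph M"
    from gamma_vals_append[OF _ this]
    have "gamma_ext f S M a - (dist z b - dist a b) \<le> gamma_ext f S M z"
      by (intro transfer) (simp add: algebra_simps)
    then show "gamma_ext f S M a + dist a b \<le> gamma_ext f S M z + dist z b" by simp
  qed
next
  fix h x assume "h \<in> ext_family f S M"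
  then have h: "star_cond UNIV M h" "\<forall>s\<in>S. h s = f s" "1-lipschitz_on UNIV h"
    by (auto simp: ext_family_def lip_extensions_def)
  show "h x \<le> gamma_ext f S M x"
    unfolding gamma_ext_def
    using gamma_vals_nonempty[OF assms(2,3)] gamma_vals_ge[OF h(1) _ h(2) _ h(3)]
    by (intro cInf_greatest) auto
qed

lemma fun_convex_ext_family: "fun_convex (ext_family f S M)"
  unfolding fun_convex_def
proof (intro ballI allI impI)
  fix g h :: "'a \<Rightarrow> real" and u v :: real
  assume g: "g \<in> ext_family f S M" and h: "h \<in> ext_family f S M"
    and uv: "0 \<le> u" "0 \<le> v" "u + v = 1"
  have lip: "k x \<le> k y + dist x y" if "k \<in> ext_family f S M" for k x y
    using that lipschitz_onD[of 1 UNIV k x y]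
    by (auto simp: ext_family_def lip_extensions_def dist_real_def)
  have star: "k a + dist a b \<le> k z + dist z b"
    if "k \<in> ext_family f S M" "(a, b) \<in> mv_graph M" for k a b z
    using that star_condD[of UNIV M k a b z] by (simp add: ext_family_def)
  \<comment> \<open>Both defining inequalities have the form \<open>k p \<le> k q + c\<close> with \<open>c\<close> independent of \<open>k\<close>.\<close>
  have comb: "u * g p + v * h p \<le> u * g q + v * h q + c"
    if "g p \<le> g q + c" "h p \<le> h q + c" for p q c
  proof -
    have "u * g p + v * h p \<le> u * (g q + c) + v * (h q + c)"
      using that uv by (intro add_mono mult_left_mono) auto
    also have "\<dots> = u * g q + v * h q + (u + v) * c" by (simp add: algebra_simps)
    finally show ?thesis using uv by simp
  qed
  show "(\<lambda>x. u * g x + v * h x) \<in> ext_family f S M"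
  proof (rule ext_familyI)
    show "u * g x + v * h x \<le> u * g y + v * h y + dist x y" for x y
      using lip[OF g] lip[OF h] by (rule comb)
  next
    fix s assume "s \<in> S"
    then have "g s = f s" "h s = f s"
      using g h by (auto simp: ext_family_def lip_extensions_def)
    then have "u * g s + v * h s = (u + v) * f s" by (simp add: algebra_simps)
    then show "u * g s + v * h s = f s" using uv by simp
  next
    fix a b z assume ab: "(a, b) \<in> mv_graph M"
    show "u * g a + v * h a + dist a b \<le> u * g z + v * h z + dist z b"
      using comb[of a z "dist z b - dist a b"] star[OF g ab, of z] star[OF h ab, of z] by simp
  qed
qed

section \<open>Extension from the whole domain\<close>

text \<open>Chains of length one are cofinal among all chains, by the bounds through the last pair.\<close>

lemma alpha_ext_dom:
  fixes M :: "'a::metric_space \<Rightarrow> 'a set"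
  assumes "star_cond (mv_dom M) M f" "mv_dom M \<noteq> {}"
  defines "V \<equiv> \<lambda>z. (\<lambda>(s, t). f s + dist s t - dist z t) ` mv_graph M"
  shows "bdd_above (V z)" "alpha_ext f (mv_dom M) M z = Sup (V z)"
proof -
  let ?A = "alpha_vals f (mv_dom M) M z"
  have sub: "V z \<subseteq> ?A"
    unfolding V_def
    by (auto intro!: alpha_vals_singleton intro: fst_graph_in_dom)
  show bdd: "bdd_above (V z)"
    using alpha_vals_bdd_above[OF assms(1,2) order_refl] sub by (rule bdd_above_mono)
  have ne: "V z \<noteq> {}"
    unfolding V_def using assms(2) by (auto elim: dom_obtains_graph)
  have "Sup ?A \<le> Sup (V z)"
  proof (rule cSup_mono[OF alpha_vals_nonempty[OF assms(2) order_refl] bdd])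
    fix v assume "v \<in> ?A"
    then obtain a b where "(a, b) \<in> mv_graph M" "v \<le> f a + dist a b - dist z b"
      using alpha_vals_le_last_pair[OF assms(1) order_refl, of "mv_dom M" f v z] by auto
    then show "\<exists>w\<in>V z. v \<le> w" unfolding V_def by force
  qed
  moreover have "Sup (V z) \<le> Sup ?A"
    using ne sub alpha_vals_bdd_above[OF assms(1,2) order_refl] by (intro cSup_subset_mono)
  ultimately show "alpha_ext f (mv_dom M) M z = Sup (V z)" unfolding alpha_ext_def by simp
qed

lemma gamma_ext_dom:
  fixes M :: "'a::metric_space \<Rightarrow> 'a set"
  assumes "star_cond (mv_dom M) M f" "mv_dom M \<noteq> {}"
  defines "V \<equiv> \<lambda>z. (\<lambda>s. f s + dist z s) ` mv_dom M"
  shows "bdd_below (V z)" "gamma_ext f (mv_dom M) M z = Inf (V z)"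
proof -
  let ?A = "gamma_vals f (mv_dom M) M z"
  have sub: "V z \<subseteq> ?A"
    unfolding V_def using gamma_vals_singleton[of _ "mv_dom M" M f z] by (auto simp: dist_commute)
  show bdd: "bdd_below (V z)"
    using gamma_vals_bdd_below[OF assms(1,2) order_refl] sub by (rule bdd_below_mono)
  have ne: "V z \<noteq> {}" unfolding V_def using assms(2) by simp
  have "Inf (V z) \<le> Inf ?A"
  proof (rule cInf_mono[OF gamma_vals_nonempty[OF assms(2) order_refl] bdd])
    fix v assume "v \<in> ?A"
    then obtain a where "a \<in> mv_dom M" "f a + dist a z \<le> v"
      using gamma_vals_ge_last_point[OF assms(1) order_refl, of "mv_dom M" f v z] by auto
    then show "\<exists>w\<in>V z. w \<le> v" unfolding V_def by (force simp: dist_commute)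
  qed
  moreover have "Inf ?A \<le> Inf (V z)"
    using ne sub gamma_vals_bdd_below[OF assms(1,2) order_refl] by (intro cInf_superset_mono)
  ultimately show "gamma_ext f (mv_dom M) M z = Inf (V z)" unfolding gamma_ext_def by simp
qed

section \<open>The identity mapping\<close>

lemma mv_dom_id: "mv_dom (mv_id S) = S"
  by (auto simp: mv_dom_def mv_id_def)

lemma mv_graph_id: "mv_graph (mv_id S) = (\<lambda>s. (s, s)) ` S"
  by (auto simp: mv_graph_def mv_id_def split: if_splits)

lemma star_cond_id:
  assumes "1-lipschitz_on D h" "S \<subseteq> D"
  shows "star_cond D (mv_id S) h"
proof -
  have "h s - h x \<le> dist x s" if "s \<in> S" "x \<in> D" for s x
    using lipschitz_onD[OF assms(1), of s x] that assms(2)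
    by (auto simp: dist_real_def dist_commute)
  then show ?thesis by (auto simp: star_cond_def mv_graph_id)
qed

lemma ext_family_id: "ext_family f S (mv_id S) = lip_extensions f S"
  by (auto simp: ext_family_def lip_extensions_def intro: star_cond_id)

section \<open>The extension theorem\<close>

theorem theorem5p7:
  shows "(\<forall>(M :: 'a::metric_space \<Rightarrow> 'a set) (f :: 'a \<Rightarrow> real) S.
      star_cond (mv_dom M) M f \<and> S \<noteq> {} \<and> S \<subseteq> mv_dom M \<longrightarrow>
        (\<exists>h. 1-lipschitz_on UNIV h \<and> (\<forall>s\<in>S. h s = f s) \<and> star_cond UNIV M h) \<and>
        fun_convex (ext_family f S M) \<and>
        ((\<forall>x. alpha_vals f S M x \<noteq> {} \<and> bdd_above (alpha_vals f S M x)) \<and>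
         is_pw_least (alpha_ext f S M) (ext_family f S M) \<and>
         (\<forall>x. gamma_vals f S M x \<noteq> {} \<and> bdd_below (gamma_vals f S M x)) \<and>
         is_pw_greatest (gamma_ext f S M) (ext_family f S M)) \<and>
        (S = mv_dom M \<longrightarrow>
          (\<forall>x. bdd_above ((\<lambda>(s, t). f s + dist s t - dist x t) ` mv_graph M) \<and>
               alpha_ext f (mv_dom M) M x = (SUP (s, t) \<in> mv_graph M. f s + dist s t - dist x t) \<and>
               bdd_below ((\<lambda>s. f s + dist x s) ` mv_dom M) \<and>
               gamma_ext f (mv_dom M) M x = (INF s \<in> mv_dom M. f s + dist x s)))) \<and>
    (\<forall>(S :: 'a set) (f :: 'a \<Rightarrow> real).
      S \<noteq> {} \<and> 1-lipschitz_on S f \<longrightarrow>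
        star_cond (mv_dom (mv_id S)) (mv_id S) f \<and>
        (\<forall>x. bdd_above ((\<lambda>s. f s - dist x s) ` S) \<and>
             alpha_ext f S (mv_id S) x = (SUP s \<in> S. f s - dist x s) \<and>
             bdd_below ((\<lambda>s. f s + dist x s) ` S) \<and>
             gamma_ext f S (mv_id S) x = (INF s \<in> S. f s + dist x s)) \<and>
        is_pw_least (alpha_ext f S (mv_id S)) (lip_extensions f S) \<and>
        is_pw_greatest (gamma_ext f S (mv_id S)) (lip_extensions f S))"
proof (rule conjI; intro allI impI; elim conjE)
  fix M :: "'a \<Rightarrow> 'a set" and f :: "'a \<Rightarrow> real" and S
  assume H: "star_cond (mv_dom M) M f" "S \<noteq> {}" "S \<subseteq> mv_dom M"
  show "(\<exists>h. 1-lipschitz_on UNIV h \<and> (\<forall>s\<in>S. h s = f s) \<and> star_cond UNIV M h) \<and>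
        fun_convex (ext_family f S M) \<and>
        ((\<forall>x. alpha_vals f S M x \<noteq> {} \<and> bdd_above (alpha_vals f S M x)) \<and>
         is_pw_least (alpha_ext f S M) (ext_family f S M) \<and>
         (\<forall>x. gamma_vals f S M x \<noteq> {} \<and> bdd_below (gamma_vals f S M x)) \<and>
         is_pw_greatest (gamma_ext f S M) (ext_family f S M)) \<and>
        (S = mv_dom M \<longrightarrow>
          (\<forall>x. bdd_above ((\<lambda>(s, t). f s + dist s t - dist x t) ` mv_graph M) \<and>
               alpha_ext f (mv_dom M) M x = (SUP (s, t) \<in> mv_graph M. f s + dist s t - dist x t) \<and>
               bdd_below ((\<lambda>s. f s + dist x s) ` mv_dom M) \<and>
               gamma_ext f (mv_dom M) M x = (INF s \<in> mv_dom M. f s + dist x s)))"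
  proof (intro conjI allI impI)
    have "alpha_ext f S M \<in> ext_family f S M"
      using alpha_ext_least[OF H] by (simp add: is_pw_least_def)
    then show "\<exists>h. 1-lipschitz_on UNIV h \<and> (\<forall>s\<in>S. h s = f s) \<and> star_cond UNIV M h"
      by (auto simp: ext_family_def lip_extensions_def)
  qed (use H alpha_ext_dom[OF H(1)] gamma_ext_dom[OF H(1)] in \<open>simp_all add:
      fun_convex_ext_family alpha_vals_nonempty alpha_vals_bdd_above alpha_ext_least
      gamma_vals_nonempty gamma_vals_bdd_below gamma_ext_greatest\<close>)
next
  fix S :: "'a set" and f :: "'a \<Rightarrow> real"
  assume S: "S \<noteq> {}" and f: "1-lipschitz_on S f"
  have star: "star_cond (mv_dom (mv_id S)) (mv_id S) f"
    using star_cond_id[OF f order_refl] by (simp add: mv_dom_id)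
  have ne: "mv_dom (mv_id S) \<noteq> {}" using S by (simp add: mv_dom_id)
  have graph: "(\<lambda>(s, t). f s + dist s t - dist x t) ` mv_graph (mv_id S)
      = (\<lambda>s. f s - dist x s) ` S" for x
    by (simp add: mv_graph_id image_image)
  note alpha = alpha_ext_dom[OF star ne, unfolded graph, unfolded mv_dom_id]
  note gamma = gamma_ext_dom[OF star ne, unfolded mv_dom_id]
  have sub: "S \<subseteq> mv_dom (mv_id S)" by (simp add: mv_dom_id)
  show "star_cond (mv_dom (mv_id S)) (mv_id S) f \<and>
        (\<forall>x. bdd_above ((\<lambda>s. f s - dist x s) ` S) \<and>
             alpha_ext f S (mv_id S) x = (SUP s \<in> S. f s - dist x s) \<and>
             bdd_below ((\<lambda>s. f s + dist x s) ` S) \<and>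
             gamma_ext f S (mv_id S) x = (INF s \<in> S. f s + dist x s)) \<and>
        is_pw_least (alpha_ext f S (mv_id S)) (lip_extensions f S) \<and>
        is_pw_greatest (gamma_ext f S (mv_id S)) (lip_extensions f S)"
    using star alpha gamma alpha_ext_least[OF star S sub] gamma_ext_greatest[OF star S sub]
    by (simp add: ext_family_id)
qed

end
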